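(* Let $\gamma:I\to\mathcal{HH}_3$ be a non-geodesic non-null curve parametrized by arclength. Then $\gamma$ is biharmonic if and only if $$k_1=\text{constant}\neq0,\qquad k_2=\text{constant},\qquad N_3B_3=0,\qquad k_1^2\varepsilon_1\varepsilon_3+k_2^2=1+4\varepsilon_3B_3^2 .$$
   Context: $\mathcal{HH}_3=(\mathbb{R}^3,g)$ is the 3-dimensional hyperbolic Heisenberg group with the semi-Riemannian metric $g=(dx)^2-(dy)^2-\frac14(dz+2y\,dx-2x\,dy)^2$ and Levi-Civita connection $\nabla$. The frame $e_1=\partial_x-2y\,\partial_z$, $e_2=\partial_y+2x\,\partial_z$, $e_3=2\,\partial_z$ is orthonormal, with $g(e_1,e_1)=1$, $g(e_2,e_2)=g(e_3,e_3)=-1$. For $X=\sum a_ie_i$, $Y=\sum b_ie_i$ put $X\wedge Y=-(a_2b_3-a_3b_2)e_1-(a_1b_3-a_3b_1)e_2+(a_1b_2-a_2b_1)e_3$. Curvature: $R(X,Y)Z=\nabla_X\nabla_YZ-\nabla_Y\nabla_XZ-\nabla_{[X,Y]}Z$. Curves: $I$ is an open interval and $\gamma:I\to\mathcal{HH}_3$ is smooth. Non-null and parametrized by arclength means that $T=\gamma'$ satisfies $g(T,T)=\varepsilon_1$ constant, $\varepsilon_1\in\{1,-1\}$ (spacelike if $1$, timelike if $-1$). $\gamma$ is biharmonic if $\nabla_T\nabla_T\nabla_TT-R(T,\nabla_TT)T=0$. Standing assumption: $\nabla_TT$ is nowhere zero ("non-geodesic") and nowhere null, so that the orthonormal Frenet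 frame $\{T,N,B\}$ is defined: $k_1=|g(\nabla_TT,\nabla_TT)|^{1/2}$ (geodesic curvature), $N$ is the unit vector field with $\nabla_TT=k_1\varepsilon_2N$, $B=T\wedge N$, where $\varepsilon_2=g(N,N)$, $\varepsilon_3=g(B,B)$; and $k_2$ (geodesic torsion) is defined by the Frenet equations $\nabla_TN=-k_1\varepsilon_1T+k_2\varepsilon_3B$, $\nabla_TB=-k_2\varepsilon_2N$. $N_3$ and $B_3$ are the $e_3$-components of $N=\sum N_ie_i$ and $B=\sum B_ie_i$. *)

theory Defs
  imports "HOL-Analysis.Analysis"
begin

section \<open>Semi-Riemannian geometry of an open coordinate patch of \<open>\<real>\<^sup>n\<close>\<close>

text \<open>A metric is a function \<open>g p u v\<close> of a point and two tangent vectors; points, tangent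
  vectors and vector fields are all written in the standard coordinates.\<close>

type_synonym 'n metric = "real ^ 'n \<Rightarrow> real ^ 'n \<Rightarrow> real ^ 'n \<Rightarrow> real"

definition metric_matrix :: "'n::finite metric \<Rightarrow> real ^ 'n \<Rightarrow> real ^ 'n ^ 'n"
  where "metric_matrix g p = (\<chi> i j. g p (axis i 1) (axis j 1))"

definition partial_deriv :: "'n::finite \<Rightarrow> (real ^ 'n \<Rightarrow> real) \<Rightarrow> real ^ 'n \<Rightarrow> real"
  where "partial_deriv i f p = frechet_derivative f (at p) (axis i 1)"

text \<open>\<open>christoffel g p k i j\<close> is the symbol \<open>\<Gamma>\<^sup>k\<^sub>i\<^sub>j\<close> of the Levi-Civita connection.\<close>

definition christoffel :: "'n::finite metric \<Rightarrow> real ^ 'n \<Rightarrow> 'n \<Rightarrow> 'n \<Rightarrow> 'n \<Rightarrow> real"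
  where "christoffel g p k i j =
    (\<Sum>l\<in>UNIV. 1/2 * matrix_inv (metric_matrix g p) $ k $ l *
      (partial_deriv i (\<lambda>q. metric_matrix g q $ j $ l) p
     + partial_deriv j (\<lambda>q. metric_matrix g q $ i $ l) p
     - partial_deriv l (\<lambda>q. metric_matrix g q $ i $ j) p))"

definition connection_form :: "'n::finite metric \<Rightarrow> real ^ 'n \<Rightarrow> real ^ 'n \<Rightarrow> real ^ 'n \<Rightarrow> real ^ 'n"
  where "connection_form g p u v =
    (\<chi> k. \<Sum>i\<in>UNIV. \<Sum>j\<in>UNIV. christoffel g p k i j * u $ i * v $ j)"

definition nabla :: "'n::finite metric \<Rightarrow> (real ^ 'n \<Rightarrow> real ^ 'n) \<Rightarrow>
    (real ^ 'n \<Rightarrow> real ^ 'n) \<Rightarrow> real ^ 'n \<Rightarrow> real ^ 'n"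
  where "nabla g X Y p = frechet_derivative Y (at p) (X p) + connection_form g p (X p) (Y p)"

definition lie_bracket :: "(real ^ 'n \<Rightarrow> real ^ 'n) \<Rightarrow> (real ^ 'n \<Rightarrow> real ^ 'n) \<Rightarrow>
    real ^ 'n::finite \<Rightarrow> real ^ 'n"
  where "lie_bracket X Y p =
    frechet_derivative Y (at p) (X p) - frechet_derivative X (at p) (Y p)"

definition curvature_field :: "'n::finite metric \<Rightarrow> (real ^ 'n \<Rightarrow> real ^ 'n) \<Rightarrow>
    (real ^ 'n \<Rightarrow> real ^ 'n) \<Rightarrow> (real ^ 'n \<Rightarrow> real ^ 'n) \<Rightarrow> real ^ 'n \<Rightarrow> real ^ 'n"
  where "curvature_field g X Y Z p =
    nabla g X (nabla g Y Z) p - nabla g Y (nabla g X Z) p - nabla g (lie_bracket X Y) Z p"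

text \<open>\<open>curvature_field\<close> is tensorial, so its value on tangent vectors at \<open>p\<close> may be computed with
  any extensions to vector fields; here the extensions with constant coordinates are used.\<close>

definition curvature :: "'n::finite metric \<Rightarrow> real ^ 'n \<Rightarrow> real ^ 'n \<Rightarrow> real ^ 'n \<Rightarrow>
    real ^ 'n \<Rightarrow> real ^ 'n"
  where "curvature g p u v w = curvature_field g (\<lambda>_. u) (\<lambda>_. v) (\<lambda>_. w) p"


section \<open>Curves\<close>

definition smooth_curve_on :: "real set \<Rightarrow> (real \<Rightarrow> 'a::real_normed_vector) \<Rightarrow> bool"
  where "smooth_curve_on I \<gamma> \<longleftrightarrow>
    (\<forall>n. \<forall>t\<in>I. ((\<lambda>f s. vector_derivative f (at s)) ^^ n) \<gamma> differentiable (at t))"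

definition velocity :: "(real \<Rightarrow> 'a::real_normed_vector) \<Rightarrow> real \<Rightarrow> 'a"
  where "velocity \<gamma> t = vector_derivative \<gamma> (at t)"

text \<open>\<open>\<nabla>\<^sub>T V\<close> for a vector field \<open>V\<close> along \<open>\<gamma>\<close> with velocity \<open>T\<close>.\<close>

definition cov_deriv :: "'n::finite metric \<Rightarrow> (real \<Rightarrow> real ^ 'n) \<Rightarrow> (real \<Rightarrow> real ^ 'n) \<Rightarrow>
    real \<Rightarrow> real ^ 'n"
  where "cov_deriv g \<gamma> V t =
    vector_derivative V (at t) + connection_form g (\<gamma> t) (velocity \<gamma> t) (V t)"

definition acceleration :: "'n::finite metric \<Rightarrow> (real \<Rightarrow> real ^ 'n) \<Rightarrow> real \<Rightarrow> real ^ 'n"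
  where "acceleration g \<gamma> = cov_deriv g \<gamma> (velocity \<gamma>)"

definition arclength_param_on :: "'n::finite metric \<Rightarrow> real set \<Rightarrow> (real \<Rightarrow> real ^ 'n) \<Rightarrow> real \<Rightarrow> bool"
  where "arclength_param_on g I \<gamma> \<epsilon> \<longleftrightarrow>
    \<epsilon> \<in> {1, -1} \<and> (\<forall>t\<in>I. g (\<gamma> t) (velocity \<gamma> t) (velocity \<gamma> t) = \<epsilon>)"

definition biharmonic_on :: "'n::finite metric \<Rightarrow> real set \<Rightarrow> (real \<Rightarrow> real ^ 'n) \<Rightarrow> bool"
  where "biharmonic_on g I \<gamma> \<longleftrightarrow> (\<forall>t\<in>I.
    cov_deriv g \<gamma> (cov_deriv g \<gamma> (acceleration g \<gamma>)) t
    - curvature g (\<gamma> t) (velocity \<gamma> t) (acceleration g \<gamma> t) (velocity \<gamma> t) = 0)"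


section \<open>The hyperbolic Heisenberg group\<close>

definition hh_form :: "real ^ 3 \<Rightarrow> real ^ 3 \<Rightarrow> real"
  where "hh_form p u = u $ 3 + 2 * p $ 2 * u $ 1 - 2 * p $ 1 * u $ 2"

definition hh_metric :: "3 metric"
  where "hh_metric p u v = u $ 1 * v $ 1 - u $ 2 * v $ 2 - 1/4 * (hh_form p u * hh_form p v)"

text \<open>Row \<open>i\<close> of \<open>hh_frame p\<close> is the value at \<open>p\<close> of the frame field \<open>e\<^sub>i\<close>.\<close>

definition hh_frame :: "real ^ 3 \<Rightarrow> real ^ 3 ^ 3"
  where "hh_frame p =
    vector [vector [1, 0, - 2 * p $ 2], vector [0, 1, 2 * p $ 1], vector [0, 0, 2]]"

definition frame_coords :: "real ^ 3 \<Rightarrow> real ^ 3 \<Rightarrow> real ^ 3"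
  where "frame_coords p u = (THE a. u = (\<Sum>i\<in>UNIV. a $ i *\<^sub>R hh_frame p $ i))"

definition hh_wedge :: "real ^ 3 \<Rightarrow> real ^ 3 \<Rightarrow> real ^ 3 \<Rightarrow> real ^ 3"
  where "hh_wedge p u v = (let a = frame_coords p u; b = frame_coords p v in
    - (a $ 2 * b $ 3 - a $ 3 * b $ 2) *\<^sub>R hh_frame p $ 1
    - (a $ 1 * b $ 3 - a $ 3 * b $ 1) *\<^sub>R hh_frame p $ 2
    + (a $ 1 * b $ 2 - a $ 2 * b $ 1) *\<^sub>R hh_frame p $ 3)"

lemma frame_coords_eq:
  "frame_coords p u = vector [u $ 1, u $ 2, hh_form p u / 2]"
  unfolding frame_coords_def
proof (rule the_equality)
  show "u = (\<Sum>i\<in>UNIV. vector [u $ 1, u $ 2, hh_form p u / 2] $ i *\<^sub>R hh_frame p $ i)"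
    by (simp add: vec_eq_iff forall_3 sum_3 hh_frame_def hh_form_def field_simps)
next
  fix a :: "real ^ 3"
  assume "u = (\<Sum>i\<in>UNIV. a $ i *\<^sub>R hh_frame p $ i)"
  then show "a = vector [u $ 1, u $ 2, hh_form p u / 2]"
    by (simp add: vec_eq_iff forall_3 sum_3 hh_frame_def hh_form_def field_simps)
qed

lemma hh_frame_orthonormal:
  "hh_metric p (hh_frame p $ i) (hh_frame p $ j) =
    (if i = j then (if i = 1 then 1 else - 1) else 0)"
  using exhaust_3[of i] exhaust_3[of j]
  by (auto simp: hh_metric_def hh_frame_def hh_form_def)


section \<open>The Frenet apparatus of a curve with nowhere null acceleration\<close>

definition curv1 :: "(real \<Rightarrow> real ^ 3) \<Rightarrow> real \<Rightarrow> real"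
  where "curv1 \<gamma> t =
    sqrt \<bar>hh_metric (\<gamma> t) (acceleration hh_metric \<gamma> t) (acceleration hh_metric \<gamma> t)\<bar>"

definition frenet_N :: "(real \<Rightarrow> real ^ 3) \<Rightarrow> real \<Rightarrow> real ^ 3"
  where "frenet_N \<gamma> t = (THE n. \<bar>hh_metric (\<gamma> t) n n\<bar> = 1 \<and>
    acceleration hh_metric \<gamma> t = (curv1 \<gamma> t * hh_metric (\<gamma> t) n n) *\<^sub>R n)"

definition frenet_B :: "(real \<Rightarrow> real ^ 3) \<Rightarrow> real \<Rightarrow> real ^ 3"
  where "frenet_B \<gamma> t = hh_wedge (\<gamma> t) (velocity \<gamma> t) (frenet_N \<gamma> t)"

definition eps1 :: "(real \<Rightarrow> real ^ 3) \<Rightarrow> real \<Rightarrow> real"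
  where "eps1 \<gamma> t = hh_metric (\<gamma> t) (velocity \<gamma> t) (velocity \<gamma> t)"

definition eps2 :: "(real \<Rightarrow> real ^ 3) \<Rightarrow> real \<Rightarrow> real"
  where "eps2 \<gamma> t = hh_metric (\<gamma> t) (frenet_N \<gamma> t) (frenet_N \<gamma> t)"

definition eps3 :: "(real \<Rightarrow> real ^ 3) \<Rightarrow> real \<Rightarrow> real"
  where "eps3 \<gamma> t = hh_metric (\<gamma> t) (frenet_B \<gamma> t) (frenet_B \<gamma> t)"

text \<open>The geodesic torsion is the coefficient determined by the last two Frenet equations.\<close>

definition curv2 :: "(real \<Rightarrow> real ^ 3) \<Rightarrow> real \<Rightarrow> real"
  where "curv2 \<gamma> t = (THE k.
    cov_deriv hh_metric \<gamma> (frenet_N \<gamma>) t =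
      - (curv1 \<gamma> t * eps1 \<gamma> t) *\<^sub>R velocity \<gamma> t + (k * eps3 \<gamma> t) *\<^sub>R frenet_B \<gamma> t \<and>
    cov_deriv hh_metric \<gamma> (frenet_B \<gamma>) t = - (k * eps2 \<gamma> t) *\<^sub>R frenet_N \<gamma> t)"

definition frenet_N3 :: "(real \<Rightarrow> real ^ 3) \<Rightarrow> real \<Rightarrow> real"
  where "frenet_N3 \<gamma> t = frame_coords (\<gamma> t) (frenet_N \<gamma> t) $ 3"

definition frenet_B3 :: "(real \<Rightarrow> real ^ 3) \<Rightarrow> real \<Rightarrow> real"
  where "frenet_B3 \<gamma> t = frame_coords (\<gamma> t) (frenet_B \<gamma> t) $ 3"

end

theory Submission
  imports Defs
begin

text \<open>Write \<open>q = g(\<nabla>\<^sub>T T, \<nabla>\<^sub>T T)\<close>, \<open>W = T \<and> \<nabla>\<^sub>T T\<close> and \<open>\<kappa> = g(\<nabla>\<^sub>T\<nabla>\<^sub>T T, W)\<close>.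
  Differentiating \<open>g(T,T)\<close> shows that the \<open>T\<close>-component of the biharmonic equation is \<open>q' = 0\<close>, that
  is, \<open>k\<^sub>1\<close> is constant. Then \<open>N\<close> and \<open>B\<close> are constant multiples of \<open>\<nabla>\<^sub>T T\<close> and \<open>W\<close>, so no
  derivatives of \<open>k\<^sub>1\<close> have to be considered, \<open>k\<^sub>2 = \<kappa> / \<bar>q\<bar>\<close>, the \<open>N\<close>-component is the
  last equation of the theorem, and the \<open>B\<close>-component is \<open>k\<^sub>2' = 4 \<epsilon>\<^sub>1 N\<^sub>3 B\<^sub>3\<close>.
  It remains to derive \<open>N\<^sub>3 B\<^sub>3 = 0\<close> from these. As \<open>B\<^sub>3' = (\<epsilon>\<^sub>1 - \<epsilon>\<^sub>2 k\<^sub>2) N\<^sub>3\<close>, differentiating the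
  last equation where \<open>N\<^sub>3 B\<^sub>3 \<noteq> 0\<close> gives \<open>k\<^sub>2 = \<epsilon>\<^sub>3 / 2\<close>; this set is open, so \<open>k\<^sub>2' = 0\<close>
  there, which contradicts \<open>k\<^sub>2' = 4 \<epsilon>\<^sub>1 N\<^sub>3 B\<^sub>3\<close>.\<close>

section \<open>Algebra in frame coordinates\<close>

definition fr_inner :: "real ^ 3 \<Rightarrow> real ^ 3 \<Rightarrow> real"
  where "fr_inner a b = a $ 1 * b $ 1 - a $ 2 * b $ 2 - a $ 3 * b $ 3"

definition fr_wedge :: "real ^ 3 \<Rightarrow> real ^ 3 \<Rightarrow> real ^ 3"
  where "fr_wedge a b = vector [- (a $ 2 * b $ 3 - a $ 3 * b $ 2),
    - (a $ 1 * b $ 3 - a $ 3 * b $ 1), a $ 1 * b $ 2 - a $ 2 * b $ 1]"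

text \<open>\<open>fr_conn a b\<close> is \<open>\<nabla>\<^sub>X Y\<close> for \<open>X = \<Sum> a\<^sub>i e\<^sub>i\<close>, \<open>Y = \<Sum> b\<^sub>i e\<^sub>i\<close> with constant
  \<open>a\<^sub>i\<close>, \<open>b\<^sub>i\<close>; the Koszul formula for the frame, with \<open>[e\<^sub>1, e\<^sub>2] = 2 e\<^sub>3\<close> as the only
  nonzero bracket, gives the coefficients.\<close>

definition fr_conn :: "real ^ 3 \<Rightarrow> real ^ 3 \<Rightarrow> real ^ 3"
  where "fr_conn a b = vector [- (a $ 2 * b $ 3 + a $ 3 * b $ 2),
    - (a $ 1 * b $ 3 + a $ 3 * b $ 1), a $ 1 * b $ 2 - a $ 2 * b $ 1]"

text \<open>The tensor \<open>R(a, b) c\<close> in frame components. Up to antisymmetry its nonzero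
  values are R(e1,e2)e1 = 3 e2, R(e1,e2)e2 = 3 e1, R(e1,e3)e1 = -e3, R(e1,e3)e3 = -e1, R(e2,e3)e2 =
  e3, R(e2,e3)e3 = -e2.\<close>

definition fr_curv :: "real ^ 3 \<Rightarrow> real ^ 3 \<Rightarrow> real ^ 3 \<Rightarrow> real ^ 3"
  where "fr_curv a b c =
    (let p12 = a $ 1 * b $ 2 - a $ 2 * b $ 1; p13 = a $ 1 * b $ 3 - a $ 3 * b $ 1;
         p23 = a $ 2 * b $ 3 - a $ 3 * b $ 2
     in vector [3 * p12 * c $ 2 - p13 * c $ 3, 3 * p12 * c $ 1 - p23 * c $ 3,
                p23 * c $ 2 - p13 * c $ 1])"

lemmas fr_defs = fr_inner_def fr_wedge_def fr_conn_def fr_curv_def Let_def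

lemma bounded_bilinear_fr_inner: "bounded_bilinear fr_inner"
  unfolding bilinear_conv_bounded_bilinear[symmetric] bilinear_def
  by (auto intro!: linearI simp: fr_inner_def algebra_simps)

lemma bounded_bilinear_fr_wedge: "bounded_bilinear fr_wedge"
  unfolding bilinear_conv_bounded_bilinear[symmetric] bilinear_def
  by (auto intro!: linearI simp: fr_wedge_def vec_eq_iff forall_3 algebra_simps)

lemma bounded_bilinear_fr_conn: "bounded_bilinear fr_conn"
  unfolding bilinear_conv_bounded_bilinear[symmetric] bilinear_def
  by (auto intro!: linearI simp: fr_conn_def vec_eq_iff forall_3 algebra_simps)

lemma fr_inner_commute: "fr_inner a b = fr_inner b a"
  by (simp add: fr_inner_def)

lemma fr_inner_conn: "fr_inner (fr_conn a u) v + fr_inner u (fr_conn a v) = 0"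
  by (simp add: fr_defs algebra_simps)

text \<open>The wedge of \<open>u\<close> and \<open>v\<close> is dual under \<open>fr_inner\<close>
  to minus the determinant, and \<open>fr_conn a\<close> is skew for \<open>fr_inner\<close>, hence
  trace free; such a map is a derivation of the wedge.\<close>

lemma fr_wedge_conn: "fr_wedge (fr_conn a u) v + fr_wedge u (fr_conn a v) = fr_conn a (fr_wedge u v)"
  by (simp add: fr_defs vec_eq_iff forall_3 algebra_simps)

text \<open>The form has determinant 1, so this Lagrange identity and \<open>fr_wedge_wedge\<close>
  keep the signs of the Euclidean cross product.\<close>

lemma fr_inner_wedge_wedge:
  "fr_inner (fr_wedge a b) (fr_wedge a b) = fr_inner a a * fr_inner b b - (fr_inner a b)\<^sup>2"
  by (simp add: fr_defs algebra_simps power2_eq_square)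

lemma fr_inner_wedge_left [simp]: "fr_inner a (fr_wedge a b) = 0" "fr_inner (fr_wedge a b) a = 0"
  by (simp_all add: fr_defs algebra_simps)

lemma fr_inner_wedge_right [simp]: "fr_inner b (fr_wedge a b) = 0" "fr_inner (fr_wedge a b) b = 0"
  by (simp_all add: fr_defs algebra_simps)

lemma fr_wedge_self [simp]: "fr_wedge a a = 0"
  by (simp add: fr_defs vec_eq_iff forall_3)

lemma fr_wedge_wedge: "fr_wedge a (fr_wedge a b) = fr_inner a b *\<^sub>R a - fr_inner a a *\<^sub>R b"
  by (simp add: fr_defs vec_eq_iff forall_3 algebra_simps)

text \<open>Cramer's rule for the Gram matrix of \<open>a\<close>, \<open>b\<close>;
  \<open>fr_wedge a b\<close> is orthogonal to both and its square is the Gram determinant. Keeping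
  that determinant as a factor avoids a nondegeneracy hypothesis.\<close>

lemma fr_basis_expansion:
  "(fr_inner a a * fr_inner b b - (fr_inner a b)\<^sup>2) *\<^sub>R c =
    (fr_inner c a * fr_inner b b - fr_inner c b * fr_inner a b) *\<^sub>R a
    + (fr_inner c b * fr_inner a a - fr_inner c a * fr_inner a b) *\<^sub>R b
    + fr_inner c (fr_wedge a b) *\<^sub>R fr_wedge a b"
  by (simp add: fr_defs vec_eq_iff forall_3 algebra_simps power2_eq_square)

lemma fr_inner_curv_1: "fr_inner (fr_curv a b a) a = 0"
  by (simp add: fr_defs algebra_simps)

text \<open>The metric distinguishes e3: the curvature of a plane sees only the length and the
  e3-component of its normal. With its two neighbours this gives all components of the curvature
  term of the biharmonic equation.\<close>

lemma fr_inner_curv_2: "fr_inner (fr_curv a b a) b =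
    - 4 * (fr_wedge a b $ 3)\<^sup>2 - fr_inner (fr_wedge a b) (fr_wedge a b)"
  by (simp add: fr_defs algebra_simps power2_eq_square)

lemma fr_inner_curv_3: "fr_inner (fr_curv a b a) (fr_wedge a b) =
    - 4 * fr_wedge a b $ 3 * fr_wedge a (fr_wedge a b) $ 3"
  by (simp add: fr_defs algebra_simps power2_eq_square)


section \<open>Connection and curvature of the hyperbolic Heisenberg group\<close>

lemma frame_coords_nth [simp]:
  "frame_coords p u $ 1 = u $ 1" "frame_coords p u $ 2 = u $ 2"
  "frame_coords p u $ 3 = (u $ 3 + 2 * p $ 2 * u $ 1 - 2 * p $ 1 * u $ 2) / 2"
  by (simp_all add: frame_coords_eq hh_form_def)

definition from_frame :: "real ^ 3 \<Rightarrow> real ^ 3 \<Rightarrow> real ^ 3"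
  where "from_frame p a = vector [a $ 1, a $ 2, 2 * a $ 3 - 2 * p $ 2 * a $ 1 + 2 * p $ 1 * a $ 2]"

lemma from_frame_coords [simp]: "from_frame p (frame_coords p u) = u"
  by (simp add: from_frame_def vec_eq_iff forall_3 field_simps)

lemma frame_coords_from_frame [simp]: "frame_coords p (from_frame p a) = a"
  by (simp add: from_frame_def vec_eq_iff forall_3)

lemma frame_coords_inject [simp]: "frame_coords p u = frame_coords p v \<longleftrightarrow> u = v"
  by (metis from_frame_coords)

lemma linear_frame_coords: "linear (frame_coords p)"
  by (auto intro!: linearI simp: vec_eq_iff forall_3 field_simps)

lemmas frame_coords_linear [simp] = linear_0[OF linear_frame_coords] linear_add[OF linear_frame_coords]
  linear_diff[OF linear_frame_coords] linear_scale[OF linear_frame_coords]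

lemma hh_metric_frame: "hh_metric p u v = fr_inner (frame_coords p u) (frame_coords p v)"
  by (simp add: hh_metric_def fr_inner_def hh_form_def)

lemma frame_coords_wedge:
  "frame_coords p (hh_wedge p u v) = fr_wedge (frame_coords p u) (frame_coords p v)"
  by (simp add: hh_wedge_def Let_def fr_wedge_def vec_eq_iff forall_3 hh_frame_def field_simps)

section \<open>Christoffel symbols in the standard coordinates\<close>

lemma metric_matrix_hh: "metric_matrix hh_metric p =
  vector [vector [1 - (p$2)\<^sup>2, p$1 * p$2, - p$2 / 2],
          vector [p$1 * p$2, - 1 - (p$1)\<^sup>2, p$1 / 2],
          vector [- p$2 / 2, p$1 / 2, - 1/4]]"
  by (simp add: metric_matrix_def vec_eq_iff forall_3 hh_metric_def hh_form_def axis_def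
      power2_eq_square)

text \<open>The inverse metric read off the orthonormal frame: the sum of the dyads of e1, e2, e3
  with signs 1, -1, -1.\<close>

definition hh_inverse :: "real ^ 3 \<Rightarrow> real ^ 3 ^ 3"
  where "hh_inverse p =
  vector [vector [1, 0, - 2 * p$2],
          vector [0, - 1, - 2 * p$1],
          vector [- 2 * p$2, - 2 * p$1, 4 * (p$2)\<^sup>2 - 4 * (p$1)\<^sup>2 - 4]]"

lemma matrix_inv_hh: "matrix_inv (metric_matrix hh_metric p) = hh_inverse p"
proof -
  have inv: "metric_matrix hh_metric p ** hh_inverse p = mat 1"
       "hh_inverse p ** metric_matrix hh_metric p = mat 1"
    by (simp_all add: metric_matrix_hh hh_inverse_def matrix_matrix_mult_def vec_eq_iff forall_3
        sum_3 mat_def field_simps power2_eq_square)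
  have "invertible (metric_matrix hh_metric p)"
    using inv invertible_def by blast
  \<comment> \<open>\<open>matrix_inv\<close> is a Hilbert choice, so its defining property is
    extracted first; uniqueness of inverses then identifies it.\<close>
  then have "metric_matrix hh_metric p ** matrix_inv (metric_matrix hh_metric p) = mat 1"
    unfolding invertible_def matrix_inv_def by (rule someI2_ex) simp
  then show ?thesis
    by (metis inv(2) matrix_mul_assoc matrix_mul_lid matrix_mul_rid)
qed

lemma partial_derivI:
  assumes "(f has_derivative f') (at p)"
  shows "partial_deriv i f p = f' (axis i 1)"
  unfolding partial_deriv_def by (metis assms frechet_derivative_at)

definition hh_conn :: "real ^ 3 \<Rightarrow> real ^ 3 \<Rightarrow> real ^ 3 \<Rightarrow> real ^ 3"
  where "hh_conn p u v = (let a = frame_coords p u; b = frame_coords p v in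
    from_frame p (vector [- (a $ 2 * b $ 3 + a $ 3 * b $ 2), - (a $ 1 * b $ 3 + a $ 3 * b $ 1), 0]))"

lemma has_derivative_nth [derivative_intros]: "((\<lambda>p. p $ i) has_derivative (\<lambda>h. h $ i)) F"
  by (rule bounded_linear_imp_has_derivative) (rule bounded_linear_vec_nth)

lemma partial_deriv_metric_matrix:
  "partial_deriv k (\<lambda>q. metric_matrix hh_metric q $ i $ j) p =
    (let a = axis k 1 :: real ^ 3 in
     vector [vector [- 2 * p$2 * a$2, a$1 * p$2 + p$1 * a$2, - a$2 / 2],
          vector [a$1 * p$2 + p$1 * a$2, - 2 * p$1 * a$1, a$1 / 2],
          vector [- a$2 / 2, a$1 / 2, 0]] $ i $ j)"
proof -
  have "\<forall>i j. ((\<lambda>q. metric_matrix hh_metric q $ i $ j) has_derivative (\<lambda>a::real^3. 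
     vector [vector [- 2 * p$2 * a$2, a$1 * p$2 + p$1 * a$2, - a$2 / 2],
          vector [a$1 * p$2 + p$1 * a$2, - 2 * p$1 * a$1, a$1 / 2],
          vector [- a$2 / 2, a$1 / 2, 0]] $ i $ j)) (at p)"
    unfolding metric_matrix_hh
    by (simp add: forall_3) (auto intro!: derivative_eq_intros simp: fun_eq_iff field_simps)
  then show ?thesis
    unfolding Let_def by (intro partial_derivI) blast
qed

lemma connection_form_hh: "connection_form hh_metric p u v = hh_conn p u v"
  by (simp add: connection_form_def christoffel_def partial_deriv_metric_matrix matrix_inv_hh
      vec_eq_iff forall_3 sum_3 Let_def hh_inverse_def hh_conn_def from_frame_def axis_def field_simps
      power2_eq_square)


text \<open>The extra vector accounts for the z-components of e1 and e2, which vary with the point;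
  it cancels the third component of \<open>fr_conn\<close>.\<close>

lemma frame_coords_hh_conn: "frame_coords p (hh_conn p u v) =
    fr_conn (frame_coords p u) (frame_coords p v) + vector [0, 0, u $ 2 * v $ 1 - u $ 1 * v $ 2]"
  by (simp add: hh_conn_def Let_def fr_conn_def vec_eq_iff forall_3)

lemma has_derivative_vec_iff:
  "(f has_derivative f') (at x within S) \<longleftrightarrow>
    (\<forall>i. ((\<lambda>x. f x $ i) has_derivative (\<lambda>h. f' h $ i)) (at x within S))"
  for f :: "'a::real_normed_vector \<Rightarrow> real ^ 'n::finite"
  by (subst has_derivative_componentwise_within) (auto simp: Basis_vec_def inner_axis)

section \<open>The curvature tensor, by differentiating \<open>hh_conn\<close> in the base
  point\<close>

lemma nabla_const: "nabla hh_metric (\<lambda>_. u) (\<lambda>_. v) = (\<lambda>p. hh_conn p u v)"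
  by (simp add: nabla_def connection_form_hh fun_eq_iff)

text \<open>\<open>a3\<close> and \<open>b3\<close> are the variations of the third frame
  coordinates of the fixed vectors \<open>v\<close> and \<open>w\<close>; the last entry is the
  product rule applied to \<open>from_frame\<close>.\<close>

lemma has_derivative_hh_conn:
  "((\<lambda>p. hh_conn p v w) has_derivative (\<lambda>h.
    let b = hh_conn p v w; a3 = h $ 2 * v $ 1 - h $ 1 * v $ 2; b3 = h $ 2 * w $ 1 - h $ 1 * w $ 2;
        d1 = - (v $ 2 * b3 + a3 * w $ 2); d2 = - (v $ 1 * b3 + a3 * w $ 1)
    in vector [d1, d2, - 2 * h $ 2 * b $ 1 - 2 * p $ 2 * d1 + 2 * h $ 1 * b $ 2 + 2 * p $ 1 * d2]))
    (at p)"
  unfolding has_derivative_vec_iff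
  by (simp add: forall_3 Let_def hh_conn_def from_frame_def)
     (auto intro!: derivative_eq_intros simp: fun_eq_iff field_simps)

lemma nabla_hh_conn: "nabla hh_metric (\<lambda>_. u) (\<lambda>p. hh_conn p v w) p =
  (let b = hh_conn p v w; a3 = u $ 2 * v $ 1 - u $ 1 * v $ 2; b3 = u $ 2 * w $ 1 - u $ 1 * w $ 2;
        d1 = - (v $ 2 * b3 + a3 * w $ 2); d2 = - (v $ 1 * b3 + a3 * w $ 1)
    in vector [d1, d2, - 2 * u $ 2 * b $ 1 - 2 * p $ 2 * d1 + 2 * u $ 1 * b $ 2 + 2 * p $ 1 * d2])
  + hh_conn p u (hh_conn p v w)"
  unfolding nabla_def connection_form_hh frechet_derivative_at[OF has_derivative_hh_conn, symmetric]
  by (rule refl)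

lemma frame_coords_curvature: "frame_coords p (curvature hh_metric p u v w) =
    fr_curv (frame_coords p u) (frame_coords p v) (frame_coords p w)"
proof -
  \<comment> \<open>Fields with constant coordinates commute.\<close>
  have "nabla hh_metric (lie_bracket (\<lambda>_. u) (\<lambda>_. v)) (\<lambda>_. w) p = 0"
    by (simp add: nabla_def lie_bracket_def connection_form_def vec_eq_iff)
  then show ?thesis
    unfolding curvature_def curvature_field_def nabla_const nabla_hh_conn
    by (simp add: vec_eq_iff forall_3 Let_def hh_conn_def from_frame_def fr_curv_def field_simps)
qed


section \<open>Vector fields along a curve in frame coordinates\<close>

text \<open>In these components the covariant derivative has coefficients that do not depend on the
  point of the curve.\<close>

definition along :: "(real \<Rightarrow> real ^ 3) \<Rightarrow> (real \<Rightarrow> real ^ 3) \<Rightarrow> real \<Rightarrow> real ^ 3"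
  where "along \<gamma> V t = frame_coords (\<gamma> t) (V t)"

lemma has_vector_derivative_vec_iff:
  "(f has_vector_derivative f') (at x within S) \<longleftrightarrow>
    (\<forall>i. ((\<lambda>x. f x $ i) has_real_derivative f' $ i) (at x within S))"
  for f :: "real \<Rightarrow> real ^ 'n::finite"
  unfolding has_vector_derivative_def has_derivative_vec_iff has_field_derivative_def
  by (simp add: mult_commute_abs)

lemma has_vector_derivative_along:
  assumes "(\<gamma> has_vector_derivative \<gamma>') (at t)" "(V has_vector_derivative V') (at t)"
  shows "(along \<gamma> V has_vector_derivative
    frame_coords (\<gamma> t) V' + vector [0, 0, \<gamma>' $ 2 * V t $ 1 - \<gamma>' $ 1 * V t $ 2]) (at t)"
  using assms unfolding has_vector_derivative_vec_iff along_def forall_3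
  by (auto intro!: derivative_eq_intros simp: field_simps)

lemma has_vector_derivative_along_cov:
  assumes "\<gamma> differentiable at t" "V differentiable at t"
  shows "(along \<gamma> V has_vector_derivative
    along \<gamma> (cov_deriv hh_metric \<gamma> V) t - fr_conn (along \<gamma> (velocity \<gamma>) t) (along \<gamma> V t)) (at t)"
proof -
  have "(along \<gamma> V has_vector_derivative frame_coords (\<gamma> t) (vector_derivative V (at t)) +
      vector [0, 0, velocity \<gamma> t $ 2 * V t $ 1 - velocity \<gamma> t $ 1 * V t $ 2]) (at t)"
    by (rule has_vector_derivative_along)
      (use assms in \<open>auto simp: velocity_def vector_derivative_works[symmetric]\<close>)
  moreover have "frame_coords (\<gamma> t) (vector_derivative V (at t)) +
      vector [0, 0, velocity \<gamma> t $ 2 * V t $ 1 - velocity \<gamma> t $ 1 * V t $ 2] =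
    along \<gamma> (cov_deriv hh_metric \<gamma> V) t - fr_conn (along \<gamma> (velocity \<gamma>) t) (along \<gamma> V t)"
    by (simp add: along_def cov_deriv_def connection_form_hh frame_coords_hh_conn)
  ultimately show ?thesis by simp
qed

lemma differentiable_along_iff:
  assumes "\<gamma> differentiable at t"
  shows "along \<gamma> V differentiable at t \<longleftrightarrow> V differentiable at t"
proof
  assume "along \<gamma> V differentiable at t"
  then obtain w where w: "(along \<gamma> V has_vector_derivative w) (at t)"
    using vector_derivative_works by blast
  obtain \<gamma>' where g: "(\<gamma> has_vector_derivative \<gamma>') (at t)"
    using assms vector_derivative_works by blast
  have "((\<lambda>s. from_frame (\<gamma> s) (along \<gamma> V s)) has_vector_derivative
     vector [w $ 1, w $ 2, 2 * w $ 3 - 2 * (\<gamma>' $ 2 * along \<gamma> V t $ 1 + \<gamma> t $ 2 * w $ 1)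
        + 2 * (\<gamma>' $ 1 * along \<gamma> V t $ 2 + \<gamma> t $ 1 * w $ 2)]) (at t)"
    using w g unfolding has_vector_derivative_vec_iff from_frame_def forall_3
    by (auto intro!: derivative_eq_intros)
  then have "(\<lambda>s. from_frame (\<gamma> s) (along \<gamma> V s)) differentiable at t"
    by (rule differentiableI_vector)
  then show "V differentiable at t"
    by (simp add: along_def)
next
  assume "V differentiable at t"
  then show "along \<gamma> V differentiable at t"
    using has_vector_derivative_along_cov[OF assms] differentiableI_vector by blast
qed

lemma along_cov_deriv_eq:
  assumes "\<gamma> differentiable at t" "(along \<gamma> V has_vector_derivative w) (at t)"
  shows "along \<gamma> (cov_deriv hh_metric \<gamma> V) t = w + fr_conn (along \<gamma> (velocity \<gamma>) t) (along \<gamma> V t)"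
proof -
  have "V differentiable at t"
    using assms differentiable_along_iff differentiableI_vector by blast
  from vector_derivative_unique_at[OF assms(2) has_vector_derivative_along_cov[OF assms(1) this]]
  show ?thesis by simp
qed

text \<open>Smoothness speaks of ordinary derivatives. It is transferred to covariant ones by
  writing their frame components as polynomials in quantities already known to be
  differentiable.\<close>

lemma smooth_differentiable:
  assumes "open I" "smooth_curve_on I \<gamma>" "t \<in> I"
  shows "\<gamma> differentiable at t" "velocity \<gamma> differentiable at t"
    "acceleration hh_metric \<gamma> differentiable at t"
    "cov_deriv hh_metric \<gamma> (acceleration hh_metric \<gamma>) differentiable at t"
proof -
  define D where "D n = ((\<lambda>f s. vector_derivative f (at s)) ^^ n) \<gamma>" for n
  have D: "(D n has_vector_derivative D (Suc n) s) (at s)" if "s \<in> I" for n s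
    using assms that unfolding smooth_curve_on_def D_def
    by (auto simp: vector_derivative_works[symmetric])
  have D0: "D 0 = \<gamma>" and D1: "D 1 = velocity \<gamma>"
    by (auto simp: D_def velocity_def)
  have D2: "D 2 = (\<lambda>s. vector_derivative (velocity \<gamma>) (at s))"
    by (simp add: D_def velocity_def[abs_def] numeral_2_eq_2)
  have \<gamma>: "\<gamma> differentiable at s" if "s \<in> I" for s
    using D[OF that, of 0] D0 differentiableI_vector by metis
  show "\<gamma> differentiable at t" using \<gamma> assms by blast
  show "velocity \<gamma> differentiable at t"
    using D[OF assms(3), of 1] D1 differentiableI_vector by metis
  \<comment> \<open>\<open>J n\<close> is the ordinary derivative of the frame components of
    \<open>D (Suc n)\<close>. The correction vanishes for \<open>n = 0\<close>, since it pairs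
    \<open>D 1\<close> with itself.\<close>
  define J where "J n s = along \<gamma> (D (Suc (Suc n))) s +
    vector [0, 0, D 1 s $ 2 * D (Suc n) s $ 1 - D 1 s $ 1 * D (Suc n) s $ 2]" for n s
  have al: "(along \<gamma> (D (Suc n)) has_vector_derivative J n s) (at s)" if "s \<in> I" for n s
    unfolding J_def along_def[of _ "D (Suc (Suc n))"]
    using D[OF that, of 0] D[OF that, of "Suc n"]
    by (intro has_vector_derivative_along) (simp_all add: D0)
  have J0: "J 0 = along \<gamma> (D 2)"
    by (auto simp: J_def fun_eq_iff vec_eq_iff forall_3 numeral_2_eq_2)
  have J1: "J 1 differentiable at t"
  proof -
    have 1: "along \<gamma> (D 3) differentiable at t"
      using al[OF assms(3), of 2] differentiableI_vector by (metis numeral_3_eq_3 numeral_2_eq_2)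
    have "(\<lambda>s. vector [0, 0, D 1 s $ 2 * D 2 s $ 1 - D 1 s $ 1 * D 2 s $ 2] :: real ^ 3)
        differentiable at t"
    proof (rule differentiableI_vector)
      show "((\<lambda>s. vector [0, 0, D 1 s $ 2 * D 2 s $ 1 - D 1 s $ 1 * D 2 s $ 2] :: real ^ 3)
        has_vector_derivative vector [0, 0, D 1 t $ 2 * D 3 t $ 1 + D 2 t $ 2 * D 2 t $ 1
          - (D 1 t $ 1 * D 3 t $ 2 + D 2 t $ 1 * D 2 t $ 2)]) (at t)"
        using D[OF assms(3), of 1] D[OF assms(3), of 2] unfolding has_vector_derivative_vec_iff
        by (auto intro!: derivative_eq_intros simp: forall_3 numeral_3_eq_3 numeral_2_eq_2)
    qed
    with 1 show ?thesis
      unfolding J_def[abs_def] by (simp add: numeral_3_eq_3 numeral_2_eq_2 differentiable_add)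
  qed
  let ?a = "along \<gamma> (velocity \<gamma>)" and ?b = "along \<gamma> (acceleration hh_metric \<gamma>)"
  have b: "?b = (\<lambda>s. J 0 s + fr_conn (?a s) (?a s))"
    unfolding J0 by (auto simp: fun_eq_iff along_def acceleration_def cov_deriv_def
        connection_form_hh frame_coords_hh_conn D2 vec_eq_iff forall_3)
  have a': "(?a has_vector_derivative J 0 s) (at s)" if "s \<in> I" for s
    using al[OF that, of 0] D1 by simp
  have J0': "(J 0 has_vector_derivative J 1 s) (at s)" if "s \<in> I" for s
    using al[OF that, of 1] J0 by (simp add: numeral_2_eq_2)
  have b': "(?b has_vector_derivative (J 1 s + (fr_conn (?a s) (J 0 s) + fr_conn (J 0 s) (?a s)))) (at s)"
    if "s \<in> I" for s
    unfolding b
    by (intro has_vector_derivative_add J0' that a'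
        bounded_bilinear.has_vector_derivative[OF bounded_bilinear_fr_conn])
  show "acceleration hh_metric \<gamma> differentiable at t"
    using differentiable_along_iff[OF \<gamma>] b' assms(3) differentiableI_vector by blast
  have c: "along \<gamma> (cov_deriv hh_metric \<gamma> (acceleration hh_metric \<gamma>)) s =
      J 1 s + (fr_conn (?a s) (J 0 s) + fr_conn (J 0 s) (?a s)) + fr_conn (?a s) (?b s)"
    if "s \<in> I" for s
    using along_cov_deriv_eq[OF \<gamma> b'] that by blast
  obtain j where j: "(J 1 has_vector_derivative j) (at t)"
    using J1 vector_derivative_works by blast
  note bil = bounded_bilinear.has_vector_derivative[OF bounded_bilinear_fr_conn]
  note w = has_vector_derivative_add[OF has_vector_derivative_add[OF j
      has_vector_derivative_add[OF bil[OF a' J0'] bil[OF J0' a']]] bil[OF a' b'],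
      OF assms(3,3,3,3,3,3)]
  \<comment> \<open>The formula for these components holds only on \<open>I\<close>, which is open,
    so the derivative carries over.\<close>
  have "along \<gamma> (cov_deriv hh_metric \<gamma> (acceleration hh_metric \<gamma>)) differentiable at t"
    by (rule differentiableI_vector, rule has_vector_derivative_transform_within_open[OF w assms(1,3)])
      (simp add: c)
  then show "cov_deriv hh_metric \<gamma> (acceleration hh_metric \<gamma>) differentiable at t"
    using differentiable_along_iff[OF \<gamma>] assms(3) differentiableI_vector by blast
qed


section \<open>Reduction of the biharmonic equation\<close>

text \<open>In frame coordinates the covariant derivative of \<open>u\<close> along a curve with velocity \<open>A\<close> is
  \<open>u' + fr_conn A u\<close>; this operator satisfies the product rule for \<open>fr_inner\<close> and \<open>fr_wedge\<close>.\<close>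

lemma fr_inner_has_derivative:
  assumes "(u has_vector_derivative u1 - fr_conn A (u t)) (at t)"
    "(v has_vector_derivative v1 - fr_conn A (v t)) (at t)"
  shows "((\<lambda>s. fr_inner (u s) (v s)) has_real_derivative fr_inner u1 (v t) + fr_inner (u t) v1) (at t)"
proof -
  interpret bounded_bilinear fr_inner by (rule bounded_bilinear_fr_inner)
  have "fr_inner (u t) (v1 - fr_conn A (v t)) + fr_inner (u1 - fr_conn A (u t)) (v t) =
      fr_inner u1 (v t) + fr_inner (u t) v1"
    using fr_inner_conn[of A "u t" "v t"] by (simp add: diff_left diff_right)
  then show ?thesis
    using has_vector_derivative[OF assms] by (simp add: has_real_derivative_iff_has_vector_derivative)
qed

lemma fr_wedge_has_derivative:
  assumes "(u has_vector_derivative u1 - fr_conn A (u t)) (at t)"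
    "(v has_vector_derivative v1 - fr_conn A (v t)) (at t)"
  shows "((\<lambda>s. fr_wedge (u s) (v s)) has_vector_derivative
    (fr_wedge u1 (v t) + fr_wedge (u t) v1) - fr_conn A (fr_wedge (u t) (v t))) (at t)"
proof -
  interpret bounded_bilinear fr_wedge by (rule bounded_bilinear_fr_wedge)
  have "fr_wedge (u t) (v1 - fr_conn A (v t)) + fr_wedge (u1 - fr_conn A (u t)) (v t) =
      (fr_wedge u1 (v t) + fr_wedge (u t) v1) - fr_conn A (fr_wedge (u t) (v t))"
    unfolding fr_wedge_conn[symmetric] by (simp add: diff_left diff_right)
  then show ?thesis
    using has_vector_derivative[OF assms] by simp
qed

lemma fr_inner_linear_simps [simp]:
  "fr_inner (u + v) w = fr_inner u w + fr_inner v w" "fr_inner (u - v) w = fr_inner u w - fr_inner v w"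
  "fr_inner w (u + v) = fr_inner w u + fr_inner w v" "fr_inner w (u - v) = fr_inner w u - fr_inner w v"
  "fr_inner (r *\<^sub>R u) w = r * fr_inner u w" "fr_inner w (r *\<^sub>R u) = r * fr_inner w u"
  by (simp_all add: fr_inner_def algebra_simps)

lemma fr_wedge_linear_simps [simp]:
  "fr_wedge w (u + v) = fr_wedge w u + fr_wedge w v" "fr_wedge w (u - v) = fr_wedge w u - fr_wedge w v"
  "fr_wedge (r *\<^sub>R u) w = r *\<^sub>R fr_wedge u w" "fr_wedge w (r *\<^sub>R u) = r *\<^sub>R fr_wedge w u"
  by (simp_all add: fr_wedge_def vec_eq_iff forall_3 algebra_simps)

text \<open>\<open>a\<close>, \<open>b\<close>, \<open>c\<close>, \<open>d\<close> are the frame coordinates of \<open>T\<close>, \<open>\<nabla>\<^sub>T T\<close>, \<open>\<nabla>\<^sub>T\<nabla>\<^sub>T T\<close>,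
  \<open>\<nabla>\<^sub>T\<nabla>\<^sub>T\<nabla>\<^sub>T T\<close>.\<close>

locale frame_curve =
  fixes I :: "real set" and a b c d :: "real \<Rightarrow> real ^ 3" and \<epsilon> :: real
  assumes open_I: "open I" and interval_I: "is_interval I"
    and a_deriv: "\<And>t. t \<in> I \<Longrightarrow> (a has_vector_derivative b t - fr_conn (a t) (a t)) (at t)"
    and b_deriv: "\<And>t. t \<in> I \<Longrightarrow> (b has_vector_derivative c t - fr_conn (a t) (b t)) (at t)"
    and c_deriv: "\<And>t. t \<in> I \<Longrightarrow> (c has_vector_derivative d t - fr_conn (a t) (c t)) (at t)"
    and unit: "\<And>t. t \<in> I \<Longrightarrow> fr_inner (a t) (a t) = \<epsilon>"
    and sign: "\<epsilon> = 1 \<or> \<epsilon> = -1"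
    and nonnull: "\<And>t. t \<in> I \<Longrightarrow> fr_inner (b t) (b t) \<noteq> 0"
begin

definition "q t = fr_inner (b t) (b t)"
definition "w t = fr_wedge (a t) (b t)"
definition "\<kappa> t = fr_inner (c t) (w t)"

lemma q_nonzero: "t \<in> I \<Longrightarrow> q t \<noteq> 0"
  by (simp add: q_def nonnull)

lemma derivative_of_const:
  assumes "\<And>s. s \<in> I \<Longrightarrow> f s = k" "t \<in> I" "(f has_real_derivative f') (at t)"
  shows "f' = 0"
proof -
  have "(f has_real_derivative 0) (at t)"
    using DERIV_const[of k "at t"] open_I assms(2)
    by (rule has_field_derivative_transform_within_open) (simp add: assms(1))
  then show ?thesis
    using assms(3) DERIV_unique by blast
qed

lemma const_of_derivative:
  assumes "\<And>t. t \<in> I \<Longrightarrow> (f has_real_derivative 0) (at t)"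
  obtains k where "\<And>t. t \<in> I \<Longrightarrow> f t = k"
proof -
  have "\<exists>k. \<forall>t\<in>I. f t = k"
    by (rule has_field_derivative_zero_constant)
      (use interval_I assms in \<open>auto simp: is_interval_convex_1 intro: has_field_derivative_at_within\<close>)
  then show ?thesis using that by blast
qed

section \<open>Consequences of unit speed\<close>

lemma q_deriv: "t \<in> I \<Longrightarrow> (q has_real_derivative 2 * fr_inner (c t) (b t)) (at t)"
  using fr_inner_has_derivative[OF b_deriv b_deriv, of t]
  by (simp add: q_def[abs_def] fr_inner_commute)

lemma inner_ba: assumes "t \<in> I" shows "fr_inner (b t) (a t) = 0"
  using derivative_of_const[OF unit assms fr_inner_has_derivative[OF a_deriv a_deriv, OF assms assms]]
  by (simp add: fr_inner_commute)

lemma inner_ab: "t \<in> I \<Longrightarrow> fr_inner (a t) (b t) = 0"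
  by (metis inner_ba fr_inner_commute)

lemma inner_ca: assumes "t \<in> I" shows "fr_inner (c t) (a t) = - q t"
  using derivative_of_const[OF inner_ba assms fr_inner_has_derivative[OF b_deriv a_deriv, OF assms assms]]
  by (simp add: q_def)

text \<open>Third differentiation of g(T,T) = const, after \<open>inner_ba\<close> and
  \<open>inner_ca\<close>; the right side is -3/2 times the derivative of \<open>q\<close>.\<close>

lemma inner_da: assumes "t \<in> I" shows "fr_inner (d t) (a t) = - 3 * fr_inner (c t) (b t)"
proof -
  have 1: "((\<lambda>t. fr_inner (c t) (a t) + q t) has_real_derivative 
     (fr_inner (d t) (a t) + fr_inner (c t) (b t)) + 2 * fr_inner (c t) (b t)) (at t)"
    by (intro DERIV_add fr_inner_has_derivative[OF c_deriv a_deriv] q_deriv assms)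
  show ?thesis
    using derivative_of_const[OF _ assms 1, of 0] by (simp add: inner_ca)
qed

lemma inner_ww: "t \<in> I \<Longrightarrow> fr_inner (w t) (w t) = \<epsilon> * q t"
  by (simp add: w_def q_def fr_inner_wedge_wedge unit inner_ab)

lemma wedge_aw: "t \<in> I \<Longrightarrow> fr_wedge (a t) (w t) = - \<epsilon> *\<^sub>R b t"
  by (simp add: w_def fr_wedge_wedge unit inner_ab)

text \<open>The Gram determinant of \<open>a t\<close>, \<open>b t\<close> is
  \<open>\<epsilon> * q t\<close>, which is nonzero, so \<open>a t\<close>, \<open>b t\<close>,
  \<open>w t\<close> form a basis.\<close>

lemma basis_eqI:
  assumes "t \<in> I" "fr_inner u (a t) = fr_inner v (a t)" "fr_inner u (b t) = fr_inner v (b t)"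
    "fr_inner u (w t) = fr_inner v (w t)"
  shows "u = v"
proof -
  have "(\<epsilon> * q t) *\<^sub>R u = (\<epsilon> * q t) *\<^sub>R v"
    using fr_basis_expansion[of "a t" "b t" u] fr_basis_expansion[of "a t" "b t" v] assms
    by (simp add: unit inner_ab q_def w_def)
  then show ?thesis
    using q_nonzero[OF assms(1)] sign by auto
qed

text \<open>The assumption of the following facts says that \<open>k\<^sub>1\<close> is constant.\<close>

context
  assumes cb: "\<And>t. t \<in> I \<Longrightarrow> fr_inner (c t) (b t) = 0"
begin

text \<open>The Frenet equation for N without normalization. The coefficients are the inner products
  of \<open>c t\<close> with \<open>a t\<close> and \<open>w t\<close>, divided by
  \<open>\<epsilon>\<close> and \<open>\<epsilon> * q t\<close>; note that \<open>\<epsilon>\<close>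
  is its own inverse.\<close>

lemma c_eq: assumes "t \<in> I" shows "c t = - (\<epsilon> * q t) *\<^sub>R a t + (\<epsilon> * \<kappa> t / q t) *\<^sub>R w t"
proof (rule basis_eqI[OF assms])
  show "fr_inner (c t) (a t) = fr_inner (- (\<epsilon> * q t) *\<^sub>R a t + (\<epsilon> * \<kappa> t / q t) *\<^sub>R w t) (a t)"
    using assms sign by (auto simp: inner_ca unit w_def)
  show "fr_inner (c t) (b t) = fr_inner (- (\<epsilon> * q t) *\<^sub>R a t + (\<epsilon> * \<kappa> t / q t) *\<^sub>R w t) (b t)"
    using assms by (simp add: cb inner_ab w_def)
  show "fr_inner (c t) (w t) = fr_inner (- (\<epsilon> * q t) *\<^sub>R a t + (\<epsilon> * \<kappa> t / q t) *\<^sub>R w t) (w t)"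
    using assms q_nonzero sign inner_ww[OF assms] fr_inner_wedge_left(1)[of "a t" "b t"]
    unfolding w_def[symmetric] by (auto simp: \<kappa>_def)
qed

lemma inner_cc: "t \<in> I \<Longrightarrow> fr_inner (c t) (c t) = \<epsilon> * ((q t)\<^sup>2 + (\<kappa> t)\<^sup>2 / q t)"
  by (subst (2) c_eq)
    (use sign q_nonzero in \<open>auto simp: inner_ca \<kappa>_def[symmetric] field_simps power2_eq_square\<close>)

text \<open>Differentiating \<open>cb\<close> gives minus the square of \<open>c t\<close>.\<close>

lemma inner_db: assumes "t \<in> I" shows "fr_inner (d t) (b t) = - \<epsilon> * ((q t)\<^sup>2 + (\<kappa> t)\<^sup>2 / q t)"
  using derivative_of_const[OF cb assms fr_inner_has_derivative[OF c_deriv b_deriv, OF assms assms]]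
    inner_cc[OF assms] by simp

lemma w_deriv:
  assumes "t \<in> I"
  shows "(w has_vector_derivative fr_wedge (a t) (c t) - fr_conn (a t) (w t)) (at t)"
  using fr_wedge_has_derivative[OF a_deriv b_deriv, OF assms assms] by (simp add: w_def[abs_def])

lemma wedge_ac: "t \<in> I \<Longrightarrow> fr_wedge (a t) (c t) = - (\<kappa> t / q t) *\<^sub>R b t"
  by (subst c_eq) (use sign in \<open>auto simp: wedge_aw\<close>)

text \<open>The other term of the product rule vanishes: the covariant derivative of
  \<open>w\<close> is \<open>fr_wedge (a t) (c t)\<close>, which is orthogonal to
  \<open>c t\<close>.\<close>

lemma \<kappa>_deriv:
  assumes "t \<in> I"
  shows "(\<kappa> has_real_derivative fr_inner (d t) (w t)) (at t)"
  using fr_inner_has_derivative[OF c_deriv w_deriv, OF assms assms]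
  by (simp add: \<kappa>_def[abs_def])

lemma w3_deriv:
  assumes "t \<in> I"
  shows "((\<lambda>t. w t $ 3) has_real_derivative (\<epsilon> - \<kappa> t / q t) * b t $ 3) (at t)"
proof -
  \<comment> \<open>Third components of \<open>fr_conn\<close> and \<open>fr_wedge\<close> agree, so
    the connection term is again a multiple of \<open>b t $ 3\<close>.\<close>
  have "fr_conn (a t) (w t) $ 3 = fr_wedge (a t) (w t) $ 3"
    by (simp add: fr_conn_def fr_wedge_def)
  then have "(fr_wedge (a t) (c t) - fr_conn (a t) (w t)) $ 3 = (\<epsilon> - \<kappa> t / q t) * b t $ 3"
    using assms by (simp add: wedge_ac wedge_aw algebra_simps)
  then show ?thesis
    using w_deriv[OF assms] unfolding has_vector_derivative_vec_iff by metis
qed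

lemma q_const: obtains k where "k \<noteq> 0" "\<And>t. t \<in> I \<Longrightarrow> q t = k"
proof (rule const_of_derivative)
  show "(q has_real_derivative 0) (at t)" if "t \<in> I" for t
    using q_deriv[OF that] cb[OF that] by simp
next
  fix k assume k: "\<And>t. t \<in> I \<Longrightarrow> q t = k"
  show ?thesis
  proof (cases "I = {}")
    case True
    \<comment> \<open>On an empty set any nonzero constant serves.\<close>
    then show ?thesis using that[of 1] by simp
  next
    case False
    then show ?thesis using that[of k] k q_nonzero by auto
  qed
qed

text \<open>Both sides are compared on the basis: the \<open>a\<close>-component holds by
  \<open>cb\<close>, the \<open>w\<close>-component is the first conjunct, and the
  \<open>b\<close>-component divided by \<open>- (\<epsilon> * q t)\<close> is the second.\<close>

lemma biharmonic_iff:
  assumes "t \<in> I"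
  shows "d t = fr_curv (a t) (b t) (a t) \<longleftrightarrow>
    fr_inner (d t) (w t) = 4 * \<epsilon> * w t $ 3 * b t $ 3 \<and>
    q t + (\<kappa> t)\<^sup>2 / (q t)\<^sup>2 = 1 + 4 * \<epsilon> * (w t $ 3)\<^sup>2 / q t"
proof -
  let ?R = "fr_curv (a t) (b t) (a t)"
  have 1: "fr_inner (d t) (a t) = fr_inner ?R (a t)"
    using assms by (simp add: inner_da cb fr_inner_curv_1)
  have 2: "fr_inner ?R (w t) = 4 * \<epsilon> * w t $ 3 * b t $ 3"
    using fr_inner_curv_3[of "a t" "b t"] assms unfolding w_def[symmetric] by (simp add: wedge_aw)
  have 3: "fr_inner ?R (b t) = - 4 * (w t $ 3)\<^sup>2 - \<epsilon> * q t"
    using fr_inner_curv_2[of "a t" "b t"] assms unfolding w_def[symmetric] by (simp add: inner_ww)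
  have "fr_inner (d t) (b t) = fr_inner ?R (b t) \<longleftrightarrow>
      q t + (\<kappa> t)\<^sup>2 / (q t)\<^sup>2 = 1 + 4 * \<epsilon> * (w t $ 3)\<^sup>2 / q t"
  proof -
    have "fr_inner (d t) (b t) - fr_inner ?R (b t) =
        - (\<epsilon> * q t) * ((q t + (\<kappa> t)\<^sup>2 / (q t)\<^sup>2) - (1 + 4 * \<epsilon> * (w t $ 3)\<^sup>2 / q t))"
      using sign q_nonzero[OF assms] unfolding 3 inner_db[OF assms]
      by (auto simp: field_simps power2_eq_square)
    then show ?thesis
      using sign q_nonzero[OF assms] by auto
  qed
  then show ?thesis
    using basis_eqI[OF assms 1] 2 by metis
qed

lemma biharmonic_imp_w3_b3:
  assumes bi: "\<And>t. t \<in> I \<Longrightarrow> d t = fr_curv (a t) (b t) (a t)" and t: "t \<in> I"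
  shows "w t $ 3 * b t $ 3 = 0"
proof (rule ccontr)
  assume nz: "w t $ 3 * b t $ 3 \<noteq> 0"
  obtain k where k: "k \<noteq> 0" "\<And>t. t \<in> I \<Longrightarrow> q t = k"
    by (rule q_const) blast
  have kd: "(\<kappa> has_real_derivative 4 * \<epsilon> * w s $ 3 * b s $ 3) (at s)" if "s \<in> I" for s
    using \<kappa>_deriv[OF that] biharmonic_iff[OF that] bi[OF that] by simp
  \<comment> \<open>This is \<open>k\<^sub>2 = \<epsilon>\<^sub>3 / 2\<close> before normalization,
    with \<open>k\<close> the value of \<open>q\<close>.\<close>
  have \<kappa>: "\<kappa> s = \<epsilon> * k / 2" if s: "s \<in> I" and nz: "w s $ 3 * b s $ 3 \<noteq> 0" for s
  proof -
    have D: "((\<lambda>s. k + (\<kappa> s)\<^sup>2 / k\<^sup>2 - (1 + 4 * \<epsilon> * (w s $ 3)\<^sup>2 / k)) has_real_derivative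
      2 * \<kappa> s * (4 * \<epsilon> * w s $ 3 * b s $ 3) / k\<^sup>2
      - 8 * \<epsilon> * w s $ 3 * ((\<epsilon> - \<kappa> s / q s) * b s $ 3) / k) (at s)"
      using k by (auto intro!: derivative_eq_intros kd w3_deriv s simp: field_simps power2_eq_square)
    have "2 * \<kappa> s * (4 * \<epsilon> * w s $ 3 * b s $ 3) / k\<^sup>2
      - 8 * \<epsilon> * w s $ 3 * ((\<epsilon> - \<kappa> s / q s) * b s $ 3) / k = 0"
      by (rule derivative_of_const[OF _ s D, of 0]) (use bi biharmonic_iff k in auto)
    \<comment> \<open>The vanishing derivative, multiplied by the square of \<open>k\<close> and
      factored.\<close>
    then have "(8 * \<epsilon> * (w s $ 3 * b s $ 3)) * (2 * \<kappa> s - \<epsilon> * k) = 0"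
      using k s by (simp add: field_simps power2_eq_square)
    then show ?thesis using nz sign by auto
  qed
  have "continuous_on I w" "continuous_on I b"
    by (auto intro!: continuous_at_imp_continuous_on has_vector_derivative_continuous w_deriv b_deriv)
  then have "continuous_on I (\<lambda>s. w s $ 3 * b s $ 3)"
    by (intro continuous_on_mult continuous_on_component)
  then have "open (I \<inter> (\<lambda>s. w s $ 3 * b s $ 3) -` (- {0}))"
    by (intro continuous_open_preimage open_I) auto
  moreover have "t \<in> I \<inter> (\<lambda>s. w s $ 3 * b s $ 3) -` (- {0})"
    using t nz by simp
  ultimately have "(\<kappa> has_real_derivative 0) (at t)"
    by (rule has_field_derivative_transform_within_open[OF DERIV_const[of "\<epsilon> * k / 2"]])
      (auto simp: \<kappa>)
  then have "4 * \<epsilon> * w t $ 3 * b t $ 3 = 0"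
    using kd[OF t] DERIV_unique by blast
  then show False
    using nz sign by auto
qed

text \<open>Once the product of third components is zero, the \<open>w\<close>-component of the
  equation says exactly that \<open>\<kappa>\<close> has derivative zero.\<close>

lemma biharmonic_iff_const:
  "(\<forall>t\<in>I. d t = fr_curv (a t) (b t) (a t)) \<longleftrightarrow>
    (\<exists>k. \<forall>t\<in>I. \<kappa> t = k) \<and> (\<forall>t\<in>I. w t $ 3 * b t $ 3 = 0) \<and>
    (\<forall>t\<in>I. q t + (\<kappa> t)\<^sup>2 / (q t)\<^sup>2 = 1 + 4 * \<epsilon> * (w t $ 3)\<^sup>2 / q t)" (is "?l \<longleftrightarrow> ?r")
proof
  assume l: ?l
  then have z: "w t $ 3 * b t $ 3 = 0" if "t \<in> I" for t
    using that biharmonic_imp_w3_b3 by blast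
  have "(\<kappa> has_real_derivative 0) (at t)" if "t \<in> I" for t
    using \<kappa>_deriv[OF that] biharmonic_iff[OF that] l that z[OF that] by (simp add: mult.assoc)
  then obtain k where "\<And>t. t \<in> I \<Longrightarrow> \<kappa> t = k"
    using const_of_derivative by blast
  then have "\<exists>k. \<forall>t\<in>I. \<kappa> t = k"
    by blast
  then show ?r
    using z l by (simp add: biharmonic_iff)
next
  assume r: ?r
  then obtain k where k: "\<And>t. t \<in> I \<Longrightarrow> \<kappa> t = k" by blast
  have "fr_inner (d t) (w t) = 4 * \<epsilon> * w t $ 3 * b t $ 3" if "t \<in> I" for t
    using derivative_of_const[OF k that \<kappa>_deriv[OF that]] r that by (simp add: mult.assoc)
  then show ?l
    using r by (simp add: biharmonic_iff)
qed

end

section \<open>Constancy of \<open>k\<^sub>1\<close> from either side of the equivalence\<close>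

lemma biharmonic_imp_cb:
  assumes "t \<in> I" "d t = fr_curv (a t) (b t) (a t)"
  shows "fr_inner (c t) (b t) = 0"
  using inner_da[OF assms(1)] assms(2) by (simp add: fr_inner_curv_1)

text \<open>\<open>k\<^sub>1\<close> determines only the absolute value of \<open>q\<close>; passing
  to the square gives a differentiable function without discussing signs.\<close>

lemma abs_q_const_imp_cb:
  assumes "\<And>t. t \<in> I \<Longrightarrow> \<bar>q t\<bar> = k" and "t \<in> I"
  shows "fr_inner (c t) (b t) = 0"
proof -
  have D: "((\<lambda>t. (q t)\<^sup>2) has_real_derivative 2 * q t * (2 * fr_inner (c t) (b t))) (at t)"
    by (rule derivative_eq_intros q_deriv assms refl)+ simp
  have "2 * q t * (2 * fr_inner (c t) (b t)) = 0"
    by (rule derivative_of_const[OF _ assms(2) D, of "k\<^sup>2"]) (metis assms(1) power2_abs)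
  then show ?thesis
    using q_nonzero assms(2) by simp
qed

end


section \<open>The Frenet apparatus\<close>

lemma frenet_N_eq:
  fixes \<gamma> :: "real \<Rightarrow> real ^ 3" and t :: real
  defines "A \<equiv> acceleration hh_metric \<gamma> t"
  defines "g \<equiv> hh_metric (\<gamma> t)"
  assumes nz: "g A A \<noteq> 0"
  shows "frenet_N \<gamma> t = (sgn (g A A) / sqrt \<bar>g A A\<bar>) *\<^sub>R A"
proof -
  define s \<sigma> where "s = sqrt \<bar>g A A\<bar>" and "\<sigma> = sgn (g A A)"
  have s: "s > 0" and \<sigma>: "\<sigma> = 1 \<or> \<sigma> = -1" and q: "g A A = \<sigma> * s\<^sup>2" and abs_q: "\<bar>g A A\<bar> = s\<^sup>2"
    using nz by (auto simp: s_def \<sigma>_def sgn_if)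
  have scale: "g (r *\<^sub>R u) (r *\<^sub>R u) = r\<^sup>2 * g u u" for r u
    by (simp add: g_def hh_metric_frame power2_eq_square)
  have N: "g ((\<sigma> / s) *\<^sub>R A) ((\<sigma> / s) *\<^sub>R A) = \<sigma>"
    using s \<sigma> unfolding scale q by (auto simp: field_simps power2_eq_square)
  show ?thesis
    unfolding frenet_N_def curv1_def A_def[symmetric] g_def[symmetric] s_def[symmetric] \<sigma>_def[symmetric]
  proof (rule the_equality)
    show "\<bar>g ((\<sigma> / s) *\<^sub>R A) ((\<sigma> / s) *\<^sub>R A)\<bar> = 1 \<and>
        A = (s * g ((\<sigma> / s) *\<^sub>R A) ((\<sigma> / s) *\<^sub>R A)) *\<^sub>R (\<sigma> / s) *\<^sub>R A"
      unfolding N using s \<sigma> by auto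
  next
    fix n assume n: "\<bar>g n n\<bar> = 1 \<and> A = (s * g n n) *\<^sub>R n"
    \<comment> \<open>Comparing squares of both sides forces the sign of \<open>g n n\<close> to be
      that of \<open>g A A\<close>.\<close>
    then have "\<sigma> * s\<^sup>2 = (s * g n n)\<^sup>2 * g n n"
      using scale[of "s * g n n" n] q by simp
    moreover have e: "g n n = 1 \<or> g n n = -1"
      using n by linarith
    ultimately have "g n n = \<sigma>"
      using s \<sigma> by (auto simp: power2_eq_square)
    then have "A = (s * \<sigma>) *\<^sub>R n"
      using n by simp
    then show "n = (\<sigma> / s) *\<^sub>R A"
      using s \<sigma> by auto
  qed
qed

locale hh_curve =
  fixes I :: "real set" and \<gamma> :: "real \<Rightarrow> real ^ 3" and \<epsilon> :: real
  assumes open_I: "open I" and interval_I: "is_interval I"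
    and smooth: "smooth_curve_on I \<gamma>"
    and arclength: "arclength_param_on hh_metric I \<gamma> \<epsilon>"
    and non_null: "\<forall>t\<in>I. hh_metric (\<gamma> t) (acceleration hh_metric \<gamma> t) (acceleration hh_metric \<gamma> t) \<noteq> 0"
begin

sublocale frame_curve I "along \<gamma> (velocity \<gamma>)" "along \<gamma> (acceleration hh_metric \<gamma>)"
  "along \<gamma> (cov_deriv hh_metric \<gamma> (acceleration hh_metric \<gamma>))"
  "along \<gamma> (cov_deriv hh_metric \<gamma> (cov_deriv hh_metric \<gamma> (acceleration hh_metric \<gamma>)))" \<epsilon>
proof
  fix t assume t: "t \<in> I"
  note sm = smooth_differentiable[OF open_I smooth t]
  show "(along \<gamma> (velocity \<gamma>) has_vector_derivative along \<gamma> (acceleration hh_metric \<gamma>) t -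
      fr_conn (along \<gamma> (velocity \<gamma>) t) (along \<gamma> (velocity \<gamma>) t)) (at t)"
    using has_vector_derivative_along_cov[OF sm(1,2)] by (simp add: acceleration_def)
  show "fr_inner (along \<gamma> (velocity \<gamma>) t) (along \<gamma> (velocity \<gamma>) t) = \<epsilon>"
    using arclength t by (simp add: arclength_param_on_def hh_metric_frame along_def)
  show "fr_inner (along \<gamma> (acceleration hh_metric \<gamma>) t) (along \<gamma> (acceleration hh_metric \<gamma>) t) \<noteq> 0"
    using non_null t by (simp add: hh_metric_frame along_def)
qed (use open_I interval_I arclength smooth_differentiable[OF open_I smooth] has_vector_derivative_along_cov in
    \<open>auto simp: arclength_param_on_def\<close>)

abbreviation "a \<equiv> along \<gamma> (velocity \<gamma>)"
abbreviation "b \<equiv> along \<gamma> (acceleration hh_metric \<gamma>)"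
abbreviation "c \<equiv> along \<gamma> (cov_deriv hh_metric \<gamma> (acceleration hh_metric \<gamma>))"

lemma q_eq: "q t = hh_metric (\<gamma> t) (acceleration hh_metric \<gamma> t) (acceleration hh_metric \<gamma> t)"
  by (simp add: q_def hh_metric_frame along_def)

lemma curv1_eq: "curv1 \<gamma> t = sqrt \<bar>q t\<bar>"
  by (simp add: curv1_def q_eq)

text \<open>The common factor that turns \<open>b\<close> and \<open>w\<close> into N and B.\<close>

definition "\<nu> t = sgn (q t) / sqrt \<bar>q t\<bar>"

lemma along_N: "t \<in> I \<Longrightarrow> along \<gamma> (frenet_N \<gamma>) t = \<nu> t *\<^sub>R b t"
  unfolding along_def by (subst frenet_N_eq) (simp_all add: non_null q_eq \<nu>_def)

lemma along_B: "t \<in> I \<Longrightarrow> along \<gamma> (frenet_B \<gamma>) t = \<nu> t *\<^sub>R w t"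
  using along_N[of t] by (simp add: frenet_B_def along_def frame_coords_wedge w_def)

lemma \<nu>_sq: "t \<in> I \<Longrightarrow> \<nu> t * \<nu> t = 1 / \<bar>q t\<bar>"
  using q_nonzero[of t] by (auto simp: \<nu>_def sgn_if)

lemma eps2_eq: "t \<in> I \<Longrightarrow> eps2 \<gamma> t = sgn (q t)"
  using along_N[of t] \<nu>_sq[of t] q_nonzero[of t]
  by (simp add: eps2_def hh_metric_frame along_def[symmetric] q_def[symmetric] mult.assoc[symmetric]
      sgn_if)

lemma eps3_eq: "t \<in> I \<Longrightarrow> eps3 \<gamma> t = \<epsilon> * sgn (q t)"
  using along_B[of t] \<nu>_sq[of t] q_nonzero[of t]
  by (simp add: eps3_def hh_metric_frame along_def[symmetric] inner_ww mult.assoc[symmetric]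
      sgn_if)

text \<open>Under \<open>cb\<close> the factor \<open>\<nu>\<close> is constant, so the covariant
  derivatives of N and B are \<open>\<nu> t\<close> times those of the acceleration and of
  \<open>w\<close>.\<close>

lemma curv2_eq:
  assumes cb: "\<And>t. t \<in> I \<Longrightarrow> fr_inner (c t) (b t) = 0" and t: "t \<in> I"
  shows "curv2 \<gamma> t = \<kappa> t / \<bar>q t\<bar>"
proof -
  note diff = smooth_differentiable(1)[OF open_I smooth t]
  obtain Q where Q: "Q \<noteq> 0" "\<And>t. t \<in> I \<Longrightarrow> q t = Q"
    using q_const[OF cb] by blast
  then have \<nu>: "\<nu> s = \<nu> t" if "s \<in> I" for s
    using t that by (simp add: \<nu>_def)
  have N': "(along \<gamma> (frenet_N \<gamma>) has_vector_derivative \<nu> t *\<^sub>R (c t - fr_conn (a t) (b t))) (at t)"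
    by (rule has_vector_derivative_transform_within_open[OF
          bounded_linear.has_vector_derivative[OF bounded_linear_scaleR_right b_deriv[OF t]] open_I t])
      (metis along_N \<nu>)
  have B': "(along \<gamma> (frenet_B \<gamma>) has_vector_derivative
      \<nu> t *\<^sub>R (fr_wedge (a t) (c t) - fr_conn (a t) (w t))) (at t)"
    by (rule has_vector_derivative_transform_within_open[OF
          bounded_linear.has_vector_derivative[OF bounded_linear_scaleR_right w_deriv[OF cb t]] open_I t])
      (auto simp: along_B \<nu>[symmetric])
  interpret fr_conn: bounded_bilinear fr_conn by (rule bounded_bilinear_fr_conn)
  have cov_N: "along \<gamma> (cov_deriv hh_metric \<gamma> (frenet_N \<gamma>)) t = \<nu> t *\<^sub>R c t"
    using along_cov_deriv_eq[OF diff N'] t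
    by (simp add: along_N fr_conn.scaleR_right scaleR_diff_right)
  have cov_B: "along \<gamma> (cov_deriv hh_metric \<gamma> (frenet_B \<gamma>)) t = - (\<nu> t * \<kappa> t / q t) *\<^sub>R b t"
    using along_cov_deriv_eq[OF diff B'] t wedge_ac[OF cb t]
    by (simp add: along_B fr_conn.scaleR_right scaleR_diff_right)
  define s \<sigma> where "s = sqrt \<bar>q t\<bar>" and "\<sigma> = sgn (q t)"
  have s: "s > 0" and \<sigma>: "\<sigma> = 1 \<or> \<sigma> = -1" and q: "q t = \<sigma> * s\<^sup>2" and abs_q: "\<bar>q t\<bar> = s\<^sup>2"
    and \<nu>t: "\<nu> t = \<sigma> / s"
    using q_nonzero[OF t] by (auto simp: s_def \<sigma>_def sgn_if \<nu>_def)
  \<comment> \<open>The first equation determines \<open>k\<close> because \<open>w t\<close> is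
    nonzero; the second holds for this \<open>k\<close>. Hence the description in
    \<open>curv2\<close> has a unique solution.\<close>
  have F: "(cov_deriv hh_metric \<gamma> (frenet_N \<gamma>) t =
      - (curv1 \<gamma> t * eps1 \<gamma> t) *\<^sub>R velocity \<gamma> t + (k * eps3 \<gamma> t) *\<^sub>R frenet_B \<gamma> t \<and>
    cov_deriv hh_metric \<gamma> (frenet_B \<gamma>) t = - (k * eps2 \<gamma> t) *\<^sub>R frenet_N \<gamma> t) \<longleftrightarrow>
    k = \<kappa> t / s\<^sup>2" (is "?A \<and> ?B \<longleftrightarrow> _") for k
  proof -
    have 1: "eps1 \<gamma> t = \<epsilon>"
      using unit[OF t] by (simp add: eps1_def hh_metric_frame along_def)
    have 2: "?A \<longleftrightarrow> \<nu> t *\<^sub>R c t = - (s * \<epsilon>) *\<^sub>R a t + (k * (\<epsilon> * \<sigma>)) *\<^sub>R \<nu> t *\<^sub>R w t"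
      unfolding cov_N[symmetric] along_B[OF t, symmetric] eps3_eq[OF t] curv1_eq 1
        s_def[symmetric] \<sigma>_def[symmetric]
      unfolding along_def
      unfolding frame_coords_linear(4)[symmetric] frame_coords_linear(2)[symmetric] frame_coords_inject ..
    have ce: "c t = - (\<epsilon> * q t) *\<^sub>R a t + (\<epsilon> * \<kappa> t / q t) *\<^sub>R w t"
      by (rule c_eq) (use cb t in auto)
    have "\<nu> t *\<^sub>R c t = - (s * \<epsilon>) *\<^sub>R a t + (\<kappa> t / s\<^sup>2 * (\<epsilon> * \<sigma>)) *\<^sub>R \<nu> t *\<^sub>R w t"
      unfolding ce q \<nu>t using s \<sigma>
      by (auto simp: scaleR_add_right scaleR_diff_right power2_eq_square field_simps)
    with 2 have A: "?A \<longleftrightarrow> (k - \<kappa> t / s\<^sup>2) * (\<epsilon> * \<sigma> * \<nu> t) = 0 \<or> w t = 0"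
      by (auto simp: algebra_simps)
    have w: "w t \<noteq> 0"
      using inner_ww[OF t] q_nonzero[OF t] sign by (auto simp: fr_inner_def)
    have B: "?B \<longleftrightarrow> - (\<nu> t * \<kappa> t / q t) *\<^sub>R b t = - (k * \<sigma>) *\<^sub>R \<nu> t *\<^sub>R b t"
      unfolding cov_B[symmetric] along_N[OF t, symmetric] eps2_eq[OF t] \<sigma>_def[symmetric]
      unfolding along_def
      unfolding frame_coords_linear(4)[symmetric] frame_coords_inject ..
    have "?B" if "k = \<kappa> t / s\<^sup>2"
      unfolding B unfolding that q \<nu>t using s \<sigma> by auto
    moreover have "?A \<longleftrightarrow> k = \<kappa> t / s\<^sup>2"
      unfolding A using w s \<sigma> \<nu>t sign by auto
    ultimately show ?thesis by blast
  qed
  show ?thesis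
    unfolding curv2_def F abs_q by (rule the_eq_trivial)
qed

lemma biharmonic_iff_frame: "biharmonic_on hh_metric I \<gamma> \<longleftrightarrow>
  (\<forall>t\<in>I. along \<gamma> (cov_deriv hh_metric \<gamma> (cov_deriv hh_metric \<gamma> (acceleration hh_metric \<gamma>))) t =
    fr_curv (a t) (b t) (a t))"
  unfolding along_def frame_coords_curvature[symmetric] by (simp add: biharmonic_on_def)

text \<open>The signs in \<open>eps3\<close> turn the absolute values of \<open>q\<close> coming
  from \<open>k\<^sub>1\<close> and the normalization of B into \<open>q\<close> itself.\<close>

lemma curvature_equation_iff:
  assumes cb: "\<And>t. t \<in> I \<Longrightarrow> fr_inner (c t) (b t) = 0" and t: "t \<in> I"
  shows "(curv1 \<gamma> t)\<^sup>2 * \<epsilon> * eps3 \<gamma> t + (curv2 \<gamma> t)\<^sup>2 = 1 + 4 * eps3 \<gamma> t * (frenet_B3 \<gamma> t)\<^sup>2 \<longleftrightarrow>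
    q t + (\<kappa> t)\<^sup>2 / (q t)\<^sup>2 = 1 + 4 * \<epsilon> * (w t $ 3)\<^sup>2 / q t"
proof -
  have B3: "(frenet_B3 \<gamma> t)\<^sup>2 = (w t $ 3)\<^sup>2 / \<bar>q t\<bar>"
    using \<nu>_sq[OF t] by (simp add: frenet_B3_def along_def[symmetric] along_B[OF t] power_mult_distrib)
      (simp add: power2_eq_square)
  have 1: "(curv1 \<gamma> t)\<^sup>2 * \<epsilon> * eps3 \<gamma> t = q t"
    using sign by (auto simp: curv1_eq eps3_eq t sgn_if)
  have 2: "(curv2 \<gamma> t)\<^sup>2 = (\<kappa> t)\<^sup>2 / (q t)\<^sup>2"
    by (simp add: curv2_eq[OF cb t] power_divide)
  have 3: "4 * eps3 \<gamma> t * (frenet_B3 \<gamma> t)\<^sup>2 = 4 * \<epsilon> * (w t $ 3)\<^sup>2 / q t"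
    unfolding B3 by (simp add: eps3_eq t sgn_if)
  show ?thesis unfolding 1 2 3 ..
qed

lemma N3_B3_iff:
  assumes "t \<in> I"
  shows "frenet_N3 \<gamma> t * frenet_B3 \<gamma> t = 0 \<longleftrightarrow> w t $ 3 * b t $ 3 = 0"
  using \<nu>_sq[OF assms] q_nonzero[OF assms]
  by (auto simp: frenet_N3_def frenet_B3_def along_def[symmetric] along_N along_B assms)

text \<open>Each side forces \<open>q\<close> to have derivative zero. Under that condition the
  clause on \<open>k\<^sub>1\<close> holds, and the remaining clauses are equivalent to the
  biharmonic equation.\<close>

lemma biharmonic_iff_frenet:
  "biharmonic_on hh_metric I \<gamma> \<longleftrightarrow>
      (\<exists>c. c \<noteq> 0 \<and> (\<forall>t\<in>I. curv1 \<gamma> t = c)) \<and>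
      (\<exists>c. \<forall>t\<in>I. curv2 \<gamma> t = c) \<and>
      (\<forall>t\<in>I. frenet_N3 \<gamma> t * frenet_B3 \<gamma> t = 0) \<and>
      (\<forall>t\<in>I. (curv1 \<gamma> t)\<^sup>2 * \<epsilon> * eps3 \<gamma> t + (curv2 \<gamma> t)\<^sup>2 = 1 + 4 * eps3 \<gamma> t * (frenet_B3 \<gamma> t)\<^sup>2)"
    (is "?bi \<longleftrightarrow> ?k1 \<and> ?rest")
proof -
  have rest: "?bi \<longleftrightarrow> ?rest" if cb: "\<And>t. t \<in> I \<Longrightarrow> fr_inner (c t) (b t) = 0"
  proof -
    obtain Q where Q: "Q \<noteq> 0" "\<And>t. t \<in> I \<Longrightarrow> q t = Q"
      using q_const[OF cb] by blast
    \<comment> \<open>\<open>\<kappa>\<close> and \<open>curv2\<close> differ by a fixed nonzero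
      factor, so they are constant together.\<close>
    have "\<kappa> t = k * \<bar>Q\<bar> \<longleftrightarrow> curv2 \<gamma> t = k" if "t \<in> I" for t k
      using Q(1) that by (auto simp: curv2_eq[OF cb] Q(2))
    then have "(\<exists>k. \<forall>t\<in>I. curv2 \<gamma> t = k) \<longleftrightarrow> (\<exists>k. \<forall>t\<in>I. \<kappa> t = k * \<bar>Q\<bar>)"
      by simp
    also have "\<dots> \<longleftrightarrow> (\<exists>k. \<forall>t\<in>I. \<kappa> t = k)"
      using Q(1) by (metis abs_eq_0 nonzero_divide_eq_eq)
    finally have r: "?rest \<longleftrightarrow> (\<exists>k. \<forall>t\<in>I. \<kappa> t = k) \<and> (\<forall>t\<in>I. w t $ 3 * b t $ 3 = 0) \<and>
        (\<forall>t\<in>I. q t + (\<kappa> t)\<^sup>2 / (q t)\<^sup>2 = 1 + 4 * \<epsilon> * (w t $ 3)\<^sup>2 / q t)"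
      by (simp add: N3_B3_iff[unfolded mult_eq_0_iff] curvature_equation_iff[OF cb])
    have "?bi \<longleftrightarrow> (\<exists>k. \<forall>t\<in>I. \<kappa> t = k) \<and> (\<forall>t\<in>I. w t $ 3 * b t $ 3 = 0) \<and>
        (\<forall>t\<in>I. q t + (\<kappa> t)\<^sup>2 / (q t)\<^sup>2 = 1 + 4 * \<epsilon> * (w t $ 3)\<^sup>2 / q t)"
      unfolding biharmonic_iff_frame by (rule biharmonic_iff_const) (rule cb)
    then show ?thesis
      using r by (rule trans[OF _ sym])
  qed
  have k1: ?k1 if cb: "\<And>t. t \<in> I \<Longrightarrow> fr_inner (c t) (b t) = 0"
  proof -
    obtain Q where "Q \<noteq> 0" "\<And>t. t \<in> I \<Longrightarrow> q t = Q"
      using q_const[OF cb] by blast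
    then show ?thesis
      by (intro exI[of _ "sqrt \<bar>Q\<bar>"]) (simp add: curv1_eq)
  qed
  have cb_k1: "fr_inner (c t) (b t) = 0" if k1: ?k1 and t: "t \<in> I" for t
  proof -
    obtain k where k: "\<And>t. t \<in> I \<Longrightarrow> sqrt \<bar>q t\<bar> = k"
      using k1 by (auto simp: curv1_eq)
    have "\<bar>q s\<bar> = k\<^sup>2" if "s \<in> I" for s
      unfolding k[OF that, symmetric] by simp
    then show ?thesis
      using t by (rule abs_q_const_imp_cb)
  qed
  have cb_bi: "fr_inner (c t) (b t) = 0" if ?bi and t: "t \<in> I" for t
    using t by (rule biharmonic_imp_cb) (use that in \<open>simp add: biharmonic_iff_frame\<close>)
  show ?thesis
  proof (rule iffI)
    assume bi: ?bi
    note cb = cb_bi[OF bi]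
    show "?k1 \<and> ?rest"
      by (rule conjI[OF k1[OF cb] iffD1[OF rest[OF cb] bi]])
  next
    assume r: "?k1 \<and> ?rest"
    note cb = cb_k1[OF conjunct1[OF r]]
    show ?bi
      by (rule iffD2[OF rest[OF cb] conjunct2[OF r]])
  qed
qed

end

theorem theorem3p4:
  fixes I :: "real set" and \<gamma> :: "real \<Rightarrow> real ^ 3" and \<epsilon>\<^sub>1 :: real
  assumes "open I" and "is_interval I" and "I \<noteq> {}"
    and smooth: "smooth_curve_on I \<gamma>"
    and arclength: "arclength_param_on hh_metric I \<gamma> \<epsilon>\<^sub>1"
    and non_geodesic: "\<forall>t\<in>I. acceleration hh_metric \<gamma> t \<noteq> 0"
    and non_null: "\<forall>t\<in>I. hh_metric (\<gamma> t) (acceleration hh_metric \<gamma> t) (acceleration hh_metric \<gamma> t) \<noteq> 0"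
  shows "biharmonic_on hh_metric I \<gamma> \<longleftrightarrow>
      (\<exists>c. c \<noteq> 0 \<and> (\<forall>t\<in>I. curv1 \<gamma> t = c)) \<and>
      (\<exists>c. \<forall>t\<in>I. curv2 \<gamma> t = c) \<and>
      (\<forall>t\<in>I. frenet_N3 \<gamma> t * frenet_B3 \<gamma> t = 0) \<and>
      (\<forall>t\<in>I. (curv1 \<gamma> t)\<^sup>2 * \<epsilon>\<^sub>1 * eps3 \<gamma> t + (curv2 \<gamma> t)\<^sup>2 = 1 + 4 * eps3 \<gamma> t * (frenet_B3 \<gamma> t)\<^sup>2)"
proof -
  interpret hh_curve I \<gamma> \<epsilon>\<^sub>1
    using assms by unfold_locales
  show ?thesis
    by (rule biharmonic_iff_frenet)
qed

end
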